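(* Suppose $J$ is a quasimetric on $X$. Then $D_J$ is a pseudometric on $X$.
   Context: A quasimetric on a nonempty set $X$ is a function $J:X\times X\to\mathbb{R}$ such that for all $x,y,z\in X$: (1) $J(x,y)\ge 0$; (2) $J(x,y)=0$ if and only if $x=y$; (3) $J(x,y)=J(y,x)$; (4) $J(x,y)\le\sigma[J(x,z)+J(z,y)]$ for some constant $\sigma\ge1$ (independent of $x,y,z$). A map $f:[a,b]\to(X,J)$ is continuous if $J(f(t_n),f(t))\to0$ whenever $t_n\to t$ in $[a,b]$. For $N\in\mathbb{N}$, $\mathcal{P}_N([a,b],(X,J))$ is the set of continuous $f:[a,b]\to(X,J)$ for which there is a partition $a=a_0<a_1<\cdots<a_N=b$ such that for each $i=0,\dots,N-1$: (i) $J$ is a metric on the subset $f([a_i,a_{i+1}])$ of $X$ (i.e. satisfies the triangle inequality there), and (ii) the restriction of $f$ to $[a_i,a_{i+1}]$ is Lipschitz, i.e. $J(f(s),f(t))\le C|s-t|$ for some constant $C\ge 0$ and all $s,t\in[a_i,a_{i+1}]$. For such $f$ the length is $L_J(f)=\int_a^b|\dot f(t)|_J\,dt$, where $|\dot f(t)|_J=\lim_{s\to t}J(f(s),f(t))/|s-t|$ provided the limit exists (it exists for almost every $t$). For $x,y\in X$ let $Path_N(x,y)=\{f\in\mathcal{P}_N([0,1],(X,J)):f(0)=x,\ f(1)=y\}$. Define $D_J^{(N)}(x,y)=\inf\{L_J(f):f\in Path_N(x,y)\}$ whenever $Path_N(x,y)$ is not empty, and $D_J^{(N)}(x,y)=\infty$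 when $Path_N(x,y)$ is empty. Since $D_J^{(N)}(x,y)$ is decreasing in $N$, define $D_J(x,y)=\lim_{N\to\infty}D_J^{(N)}(x,y)$. A pseudometric on $X$ is a function $d:X\times X\to[0,+\infty)$ such that $d(x,y)\ge0$, $d(x,y)=d(y,x)$ and $d(x,y)\le d(x,z)+d(z,y)$ for all $x,y,z\in X$; $d(x,y)=0$ does not necessarily imply $x=y$.
   Formalization: D_J may be infinite (e.g. a two-point X, where no path joins the points), so the pseudometric axioms are proved with values in [0,∞]; D_J is shown to be a pseudometric with values in [0,+∞) when it is finite everywhere. *)

theory Defs
  imports "HOL-Analysis.Analysis"
begin

text \<open>
  The space is a carrier set \<open>X\<close> in an arbitrary type; nothing is assumed about \<open>J\<close> outside
  \<open>X \<times> X\<close>. The library locale \<open>Metric_space\<close> is not used below because it demands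
  nonnegativity and symmetry on the whole type.
\<close>

definition quasimetric_on :: "'a set \<Rightarrow> ('a \<Rightarrow> 'a \<Rightarrow> real) \<Rightarrow> bool" where
  "quasimetric_on X J \<longleftrightarrow>
     X \<noteq> {} \<and>
     (\<forall>x\<in>X. \<forall>y\<in>X. 0 \<le> J x y) \<and>
     (\<forall>x\<in>X. \<forall>y\<in>X. J x y = 0 \<longleftrightarrow> x = y) \<and>
     (\<forall>x\<in>X. \<forall>y\<in>X. J x y = J y x) \<and>
     (\<exists>\<sigma>\<ge>1. \<forall>x\<in>X. \<forall>y\<in>X. \<forall>z\<in>X. J x y \<le> \<sigma> * (J x z + J z y))"

definition metric_on :: "'a set \<Rightarrow> ('a \<Rightarrow> 'a \<Rightarrow> real) \<Rightarrow> bool" where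
  "metric_on S J \<longleftrightarrow>
     (\<forall>x\<in>S. \<forall>y\<in>S. 0 \<le> J x y) \<and>
     (\<forall>x\<in>S. \<forall>y\<in>S. J x y = 0 \<longleftrightarrow> x = y) \<and>
     (\<forall>x\<in>S. \<forall>y\<in>S. J x y = J y x) \<and>
     (\<forall>x\<in>S. \<forall>y\<in>S. \<forall>z\<in>S. J x y \<le> J x z + J z y)"

definition continuous_path :: "('a \<Rightarrow> 'a \<Rightarrow> real) \<Rightarrow> real \<Rightarrow> real \<Rightarrow> (real \<Rightarrow> 'a) \<Rightarrow> bool" where
  "continuous_path J a b f \<longleftrightarrow>
     (\<forall>u t. (\<forall>n. u n \<in> {a..b}) \<and> t \<in> {a..b} \<and> u \<longlonglongrightarrow> t \<longrightarrow>
        (\<lambda>n. J (f (u n)) (f t)) \<longlonglongrightarrow> 0)"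

definition lipschitz_path :: "('a \<Rightarrow> 'a \<Rightarrow> real) \<Rightarrow> real \<Rightarrow> real \<Rightarrow> (real \<Rightarrow> 'a) \<Rightarrow> bool" where
  "lipschitz_path J a b f \<longleftrightarrow>
     (\<exists>C\<ge>0. \<forall>s\<in>{a..b}. \<forall>t\<in>{a..b}. J (f s) (f t) \<le> C * \<bar>s - t\<bar>)"

text \<open>
  Paths are total functions on the reals of which only the values on \<open>{a..b}\<close> matter.
  For \<open>a < b\<close> the set is empty when \<open>N = 0\<close>.
\<close>

definition pw_paths ::
  "nat \<Rightarrow> real \<Rightarrow> real \<Rightarrow> 'a set \<Rightarrow> ('a \<Rightarrow> 'a \<Rightarrow> real) \<Rightarrow> (real \<Rightarrow> 'a) set" where
  "pw_paths N a b X J =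
     {f. f ` {a..b} \<subseteq> X \<and> continuous_path J a b f \<and>
         (\<exists>p :: nat \<Rightarrow> real. p 0 = a \<and> p N = b \<and>
            (\<forall>i<N. p i < p (Suc i) \<and>
                   metric_on (f ` {p i..p (Suc i)}) J \<and>
                   lipschitz_path J (p i) (p (Suc i)) f))}"

text \<open>
  The limit defining the metric speed exists for almost every \<open>t\<close> when \<open>f\<close> lies in
  \<^const>\<open>pw_paths\<close>; the value 0 at the remaining points does not affect the length.
\<close>

definition metric_speed ::
  "('a \<Rightarrow> 'a \<Rightarrow> real) \<Rightarrow> real \<Rightarrow> real \<Rightarrow> (real \<Rightarrow> 'a) \<Rightarrow> real \<Rightarrow> real" where
  "metric_speed J a b f t =
     (if \<exists>l. ((\<lambda>s. J (f s) (f t) / \<bar>s - t\<bar>) \<longlongrightarrow> l) (at t within {a..b})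
      then Lim (at t within {a..b}) (\<lambda>s. J (f s) (f t) / \<bar>s - t\<bar>)
      else 0)"

definition path_len :: "('a \<Rightarrow> 'a \<Rightarrow> real) \<Rightarrow> real \<Rightarrow> real \<Rightarrow> (real \<Rightarrow> 'a) \<Rightarrow> real" where
  "path_len J a b f = (LINT t:{a..b}|lebesgue. metric_speed J a b f t)"

definition Path :: "nat \<Rightarrow> 'a set \<Rightarrow> ('a \<Rightarrow> 'a \<Rightarrow> real) \<Rightarrow> 'a \<Rightarrow> 'a \<Rightarrow> (real \<Rightarrow> 'a) set" where
  "Path N X J x y = {f \<in> pw_paths N 0 1 X J. f 0 = x \<and> f 1 = y}"

definition D_N :: "nat \<Rightarrow> 'a set \<Rightarrow> ('a \<Rightarrow> 'a \<Rightarrow> real) \<Rightarrow> 'a \<Rightarrow> 'a \<Rightarrow> ereal" where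
  "D_N N X J x y =
     (if Path N X J x y = {} then \<infinity> else (INF f\<in>Path N X J x y. ereal (path_len J 0 1 f)))"

definition D_J :: "'a set \<Rightarrow> ('a \<Rightarrow> 'a \<Rightarrow> real) \<Rightarrow> 'a \<Rightarrow> 'a \<Rightarrow> ereal" where
  "D_J X J x y = lim (\<lambda>N. D_N N X J x y)"

text \<open>
  The codomain is left generic: with values in \<^typ>\<open>real\<close> this is a pseudometric in the usual
  sense, with values in \<^typ>\<open>ereal\<close> an extended one, which may take the value \<open>\<infinity>\<close>.
  The extended notion is needed because \<^const>\<open>D_J\<close> is infinite between points that no
  admissible path joins.
\<close>

definition pseudometric_on :: "'a set \<Rightarrow> ('a \<Rightarrow> 'a \<Rightarrow> 'b::ordered_comm_monoid_add) \<Rightarrow> bool" where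
  "pseudometric_on X d \<longleftrightarrow>
     (\<forall>x\<in>X. \<forall>y\<in>X. 0 \<le> d x y) \<and>
     (\<forall>x\<in>X. \<forall>y\<in>X. d x y = d y x) \<and>
     (\<forall>x\<in>X. \<forall>y\<in>X. \<forall>z\<in>X. d x y \<le> d x z + d z y)"

end

theory Submission imports Defs begin

text \<open>
  Reversing a path preserves its length, which gives symmetry. Running an \<open>N\<close>-piece path and then an
  \<open>M\<close>-piece path at double speed gives an \<open>(N + M)\<close>-piece path whose length is at most the sum, so
  \<open>D\<^sup>(\<^sup>N\<^sup>+\<^sup>M\<^sup>) x y \<le> D\<^sup>(\<^sup>N\<^sup>) x z + D\<^sup>(\<^sup>M\<^sup>) z y\<close>; the triangle inequality follows with \<open>M = N\<close>
  in the limit.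
\<close>

section \<open>Metric speed: its sign and its behaviour under affine reparametrization\<close>

lemma metric_speed_nonneg:
  assumes "a < b" "t \<in> {a..b}" and nonneg: "\<And>s. s \<in> {a..b} \<Longrightarrow> 0 \<le> J (f s) (f t)"
  shows "0 \<le> metric_speed J a b f t"
proof (cases "\<exists>l. ((\<lambda>s. J (f s) (f t) / \<bar>s - t\<bar>) \<longlongrightarrow> l) (at t within {a..b})")
  case True
  then obtain l where l: "((\<lambda>s. J (f s) (f t) / \<bar>s - t\<bar>) \<longlongrightarrow> l) (at t within {a..b})"
    by blast
  have nt: "\<not> trivial_limit (at t within {a..b})"
    using assms by (simp add: trivial_limit_within)
  have "0 \<le> l"
    by (rule tendsto_lowerbound[OF l _ nt]) (auto simp: eventually_at_filter nonneg)
  then show ?thesis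
    using l tendsto_Lim[OF nt l] by (auto simp: metric_speed_def)
qed (simp add: metric_speed_def)

text \<open>An affine map stretches \<open>\<bar>s - t\<bar>\<close> by \<open>\<bar>c\<bar>\<close>
  and carries punctured neighbourhoods of \<open>t\<close> to those of its image, so the quotients
  differ by the factor \<open>\<bar>c\<bar>\<close>. Speed is local: agreement on an open
  \<open>S\<close> suffices, which lets each half of a joined path be treated on its own.\<close>

lemma metric_speed_affine:
  fixes c d :: real
  assumes "c \<noteq> 0" "a < b" "a' < b'" "open S" "t \<in> S" "t \<in> {a..b}"
    and dom: "\<And>s. s \<in> S \<Longrightarrow> s \<in> {a..b} \<longleftrightarrow> d + c * s \<in> {a'..b'}"
    and h: "\<And>s. s \<in> S \<Longrightarrow> s \<in> {a..b} \<Longrightarrow> h s = f (d + c * s)"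
  shows "metric_speed J a b h t = \<bar>c\<bar> * metric_speed J a' b' f (d + c * t)"
proof -
  define \<phi> where "\<phi> s = d + c * s" for s
  define H where "H s = J (h s) (h t) / \<bar>s - t\<bar>" for s
  define F where "F s = J (f s) (f (\<phi> t)) / \<bar>s - \<phi> t\<bar>" for s
  let ?A = "at t within {a..b}" and ?B = "at (\<phi> t) within {a'..b'}"
  have bij: "bij \<phi>"
    by (rule bij_betw_byWitness[where f' = "\<lambda>y. (y - d) / c"])
      (use \<open>c \<noteq> 0\<close> in \<open>auto simp: \<phi>_def\<close>)
  have opn: "open (\<phi> ` U)" if "open U" for U
  proof -
    have "\<phi> ` U = (\<lambda>y. (y - d) / c) -` U"
      using \<open>c \<noteq> 0\<close> by (auto simp: \<phi>_def image_iff field_simps intro!: bexI[of _ "(_ - d) / c"])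
    moreover have "open ((\<lambda>y. (y - d) / c) -` U)"
      using \<open>c \<noteq> 0\<close> by (intro open_vimage that continuous_intros) auto
    ultimately show ?thesis by simp
  qed
  \<comment> \<open>Both filters are cut down to the neighbourhood on which \<open>dom\<close>
    matches the two domains; there \<open>\<phi>\<close> transports one filter onto the
    other.\<close>
  have A: "?A = at t within {a..b} \<inter> S"
    by (rule at_within_nhd[of _ S]) (use assms in auto)
  have img: "\<phi> ` ({a..b} \<inter> S) = {a'..b'} \<inter> \<phi> ` S"
    using dom by (auto simp: \<phi>_def)
  have B: "?B = at (\<phi> t) within {a'..b'} \<inter> \<phi> ` S"
    by (rule at_within_nhd[of _ "\<phi> ` S"]) (use assms opn in auto)
  have filt: "filtermap \<phi> ?A = ?B"
    unfolding A B img[symmetric]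
    by (rule filtermap_linear_at_within[OF bij _ opn]) (auto simp: \<phi>_def[abs_def])
  have "\<forall>\<^sub>F s in ?A. H s = \<bar>c\<bar> * F (\<phi> s)"
    unfolding A eventually_at_filter
  proof (intro always_eventually allI impI)
    fix s assume s: "s \<noteq> t" "s \<in> {a..b} \<inter> S"
    have "\<bar>\<phi> s - \<phi> t\<bar> = \<bar>c\<bar> * \<bar>s - t\<bar>"
      by (simp add: \<phi>_def abs_mult flip: right_diff_distrib)
    then show "H s = \<bar>c\<bar> * F (\<phi> s)"
      using s assms by (simp add: H_def F_def h \<phi>_def)
  qed
  then have "(H \<longlongrightarrow> \<bar>c\<bar> * l) ?A \<longleftrightarrow> ((\<lambda>s. \<bar>c\<bar> * F (\<phi> s)) \<longlongrightarrow> \<bar>c\<bar> * l) ?A" for l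
    by (rule filterlim_cong[OF refl refl])
  then have lim: "(H \<longlongrightarrow> \<bar>c\<bar> * l) ?A \<longleftrightarrow> (F \<longlongrightarrow> l) ?B" for l
    using \<open>c \<noteq> 0\<close> by (simp add: tendsto_mult_left_iff filterlim_filtermap flip: filt)
  have nA: "\<not> trivial_limit ?A"
    using assms by (simp add: trivial_limit_within)
  then have nB: "\<not> trivial_limit ?B"
    by (simp flip: filt add: filtermap_bot_iff)
  \<comment> \<open>The default speed 0 must occur at corresponding points, so existence of the
    limit is transferred in both directions.\<close>
  have ex: "(\<exists>l. (H \<longlongrightarrow> l) ?A) \<longleftrightarrow> (\<exists>l. (F \<longlongrightarrow> l) ?B)"
  proof
    assume "\<exists>l. (H \<longlongrightarrow> l) ?A"
    then obtain l where "(H \<longlongrightarrow> l) ?A" by blast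
    then show "\<exists>l. (F \<longlongrightarrow> l) ?B"
      using \<open>c \<noteq> 0\<close> lim[of "l / \<bar>c\<bar>"] by auto
  qed (use lim in blast)
  have "metric_speed J a b h t = (if \<exists>l. (H \<longlongrightarrow> l) ?A then Lim ?A H else 0)"
    by (simp add: metric_speed_def H_def[abs_def])
  also have "\<dots> = \<bar>c\<bar> * (if \<exists>l. (F \<longlongrightarrow> l) ?B then Lim ?B F else 0)"
  proof (cases "\<exists>l. (F \<longlongrightarrow> l) ?B")
    case True
    then obtain l where "(F \<longlongrightarrow> l) ?B" by blast
    then have "Lim ?B F = l" "Lim ?A H = \<bar>c\<bar> * l"
      using tendsto_Lim[OF nB] tendsto_Lim[OF nA] lim by blast+
    then show ?thesis using True ex by simp
  qed (simp add: ex)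
  also have "\<dots> = \<bar>c\<bar> * metric_speed J a' b' f (d + c * t)"
    by (simp add: metric_speed_def F_def[abs_def] \<phi>_def)
  finally show ?thesis .
qed

section \<open>Changing a Lebesgue integrand at a single point\<close>

lemma borel_measurable_lebesgue_cong_except:
  fixes f g :: "real \<Rightarrow> real"
  assumes "\<And>x. x \<noteq> k \<Longrightarrow> f x = g x" "f \<in> borel_measurable lebesgue"
  shows "g \<in> borel_measurable lebesgue"
proof -
  have "g = (\<lambda>x. if x \<in> {k} then g k else f x)"
    using assms(1) by auto
  moreover have "(\<lambda>x. if x \<in> {k} then g k else f x) \<in> borel_measurable lebesgue"
    using assms(2) by (intro measurable_If_set) auto
  ultimately show ?thesis by simp
qed

text \<open>Meant for the junction \<open>1/2\<close> of a joined path, where the speed is not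
  controlled. The congruence rule for a.e. equal functions wants both measurable; the previous lemma
  carries measurability from one to the other.\<close>

lemma has_bochner_integral_lebesgue_cong_except:
  fixes f g :: "real \<Rightarrow> real"
  assumes "\<And>x. x \<noteq> k \<Longrightarrow> f x = g x"
  shows "has_bochner_integral lebesgue f i \<longleftrightarrow> has_bochner_integral lebesgue g i"
proof -
  have "AE x in lebesgue. f x = g x"
    by (rule AE_I'[of "{k}"]) (use assms in auto)
  moreover have "f \<in> borel_measurable lebesgue \<longleftrightarrow> g \<in> borel_measurable lebesgue"
    using borel_measurable_lebesgue_cong_except[of k f g, OF assms]
      borel_measurable_lebesgue_cong_except[of k g f, OF assms[symmetric]] by blast
  ultimately show ?thesis
    using has_bochner_integral_cong_AE[of f lebesgue g i]
      borel_measurable_has_bochner_integral[of lebesgue f i]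
      borel_measurable_has_bochner_integral[of lebesgue g i] by argo
qed

section \<open>Reversed and joined paths and their lengths\<close>

definition path_rev :: "(real \<Rightarrow> 'a) \<Rightarrow> real \<Rightarrow> 'a" where
  "path_rev f t = f (1 - t)"

definition path_join :: "(real \<Rightarrow> 'a) \<Rightarrow> (real \<Rightarrow> 'a) \<Rightarrow> real \<Rightarrow> 'a" where
  "path_join f g t = (if t \<le> 1/2 then f (2 * t) else g (2 * t - 1))"

lemma path_join_right:
  assumes "f 1 = g 0" "1/2 \<le> t"
  shows "path_join f g t = g (2 * t - 1)"
proof (cases "t = 1/2")
  case True
  show ?thesis unfolding True using assms(1) by (simp add: path_join_def)
next
  case False
  then show ?thesis using assms(2) by (simp add: path_join_def)
qed

text \<open>The speed at \<open>t\<close> is that of \<open>f\<close> at \<open>1 - t\<close>, and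
  this reflection preserves Lebesgue measure. The substitution rule also covers a nonintegrable
  speed, both integrals then being 0.\<close>

lemma path_len_rev: "path_len J 0 1 (path_rev f) = path_len J 0 1 f"
proof -
  have "metric_speed J 0 1 (path_rev f) t = metric_speed J 0 1 f (1 - t)" if "t \<in> {0..1}" for t
    using metric_speed_affine[of "-1" 0 1 0 1 UNIV t 1 "path_rev f" f J] that
    by (auto simp: path_rev_def)
  then have "path_len J 0 1 (path_rev f)
      = (LINT t|lebesgue. indicator {0..1} (1 - t) * metric_speed J 0 1 f (1 - t))"
    unfolding path_len_def set_lebesgue_integral_def
    by (intro Bochner_Integration.integral_cong) (auto simp: indicator_def)
  then show ?thesis
    using lebesgue_integral_real_affine[of "-1"
        "\<lambda>t. indicator {0..1} t * metric_speed J 0 1 f t" 1]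
    by (simp add: path_len_def set_lebesgue_integral_def)
qed

lemma path_len_nonneg:
  assumes "f ` {0..1} \<subseteq> X" "\<forall>x\<in>X. \<forall>y\<in>X. 0 \<le> J x y"
  shows "0 \<le> path_len J 0 1 f"
  unfolding path_len_def set_lebesgue_integral_def
proof (rule Bochner_Integration.integral_nonneg)
  fix t :: real
  show "0 \<le> indicator {0..1} t *\<^sub>R metric_speed J 0 1 f t"
    using metric_speed_nonneg[of 0 1 t J f] assms by (cases "t \<in> {0..1}") (auto simp: image_subset_iff)
qed

text \<open>
  No integrability of the speeds is needed: the integral of a function that is not integrable is 0,
  so the inequality holds trivially when the speed of the joined path is not integrable, and otherwise
  both halves are integrable.
\<close>

lemma path_len_join:
  assumes fX: "f ` {0..1} \<subseteq> X" and gX: "g ` {0..1} \<subseteq> X" and fg: "f 1 = g 0"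
    and J: "\<forall>x\<in>X. \<forall>y\<in>X. 0 \<le> J x y"
  shows "path_len J 0 1 (path_join f g) \<le> path_len J 0 1 f + path_len J 0 1 g"
proof -
  define H where "H t = indicator {0..1} t * metric_speed J 0 1 (path_join f g) t" for t :: real
  define F where "F t = indicator {0..1} t * metric_speed J 0 1 f t" for t :: real
  define G where "G t = indicator {0..1} t * metric_speed J 0 1 g t" for t :: real
  have len: "path_len J 0 1 (path_join f g) = integral\<^sup>L lebesgue H"
    "path_len J 0 1 f = integral\<^sup>L lebesgue F" "path_len J 0 1 g = integral\<^sup>L lebesgue G"
    by (simp_all add: path_len_def set_lebesgue_integral_def H_def[abs_def] F_def[abs_def] G_def[abs_def])
  \<comment> \<open>Left of the junction the path is \<open>f\<close> at double speed, whence the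
    factor 2. The junction itself is excluded, since the one-sided speeds there may differ.\<close>
  have left: "H t = 2 * F (2 * t)" if "t < 1/2" for t
  proof (cases "0 \<le> t")
    case True
    then have "metric_speed J 0 1 (path_join f g) t = 2 * metric_speed J 0 1 f (2 * t)"
      using metric_speed_affine[of 2 0 1 0 1 "{..<1/2}" t 0 "path_join f g" f J] that
      by (auto simp: path_join_def)
    then show ?thesis using True that by (simp add: H_def F_def)
  qed (use that in \<open>simp add: H_def F_def\<close>)
  have right: "H t = 2 * G (2 * t - 1)" if "1/2 < t" for t
  proof (cases "t \<le> 1")
    case True
    then have "metric_speed J 0 1 (path_join f g) t = 2 * metric_speed J 0 1 g (2 * t - 1)"
      using metric_speed_affine[of 2 0 1 0 1 "{1/2<..}" t "-1" "path_join f g" g J] that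
      by (auto simp: path_join_def)
    then show ?thesis using True that by (simp add: H_def G_def)
  qed (use that in \<open>simp add: H_def G_def\<close>)
  show ?thesis
  proof (cases "integrable lebesgue H")
    case False
    then show ?thesis
      using path_len_nonneg[OF fX J] path_len_nonneg[OF gX J]
      by (simp add: len not_integrable_integral_eq)
  next
    case True
    define L R where "L t = indicator {..<1/2} t * H t" and "R t = indicator {1/2<..} t * H t" for t :: real
    have int: "integrable lebesgue L" "integrable lebesgue R"
      unfolding L_def[abs_def] R_def[abs_def]
      using True by (auto intro!: integrable_real_mult_indicator simp: mult.commute[of "indicator _ _"])
    have "has_bochner_integral lebesgue (\<lambda>t. L t + R t) (integral\<^sup>L lebesgue L + integral\<^sup>L lebesgue R)"
      using int by (intro has_bochner_integral_add has_bochner_integral_integrable)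
    then have "has_bochner_integral lebesgue H (integral\<^sup>L lebesgue L + integral\<^sup>L lebesgue R)"
      by (subst has_bochner_integral_lebesgue_cong_except[where k = "1/2" and g = "\<lambda>t. L t + R t"])
        (auto simp: L_def R_def indicator_def)
    then have H: "integral\<^sup>L lebesgue H = integral\<^sup>L lebesgue L + integral\<^sup>L lebesgue R"
      by (rule has_bochner_integral_integral_eq)
    have "has_bochner_integral lebesgue L (integral\<^sup>L lebesgue L)"
      using int by (simp add: has_bochner_integral_integrable)
    \<comment> \<open>Beyond \<open>1/2\<close> both functions vanish, because \<open>F\<close> is 0
      to the right of 1. The factor 2 from the speed is exactly the Jacobian of the substitution
      that follows.\<close>
    then have "has_bochner_integral lebesgue (\<lambda>t. 2 * F (0 + 2 * t)) (integral\<^sup>L lebesgue L)"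
      by (subst has_bochner_integral_lebesgue_cong_except[where k = "1/2" and g = L])
        (auto simp: L_def F_def indicator_def left)
    then have "integral\<^sup>L lebesgue F = integral\<^sup>L lebesgue L"
      using lebesgue_integral_real_affine[of 2 F 0] has_bochner_integral_integral_eq by fastforce
    moreover have "has_bochner_integral lebesgue R (integral\<^sup>L lebesgue R)"
      using int by (simp add: has_bochner_integral_integrable)
    then have "has_bochner_integral lebesgue (\<lambda>t. 2 * G (- 1 + 2 * t)) (integral\<^sup>L lebesgue R)"
      by (subst has_bochner_integral_lebesgue_cong_except[where k = "1/2" and g = R])
        (auto simp: R_def G_def indicator_def right)
    then have "integral\<^sup>L lebesgue G = integral\<^sup>L lebesgue R"
      using lebesgue_integral_real_affine[of 2 G "-1"] has_bochner_integral_integral_eq by fastforce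
    ultimately show ?thesis
      using H by (simp add: len)
  qed
qed

section \<open>Admissibility of refined, reversed and joined paths\<close>

definition metric_piece :: "('a \<Rightarrow> 'a \<Rightarrow> real) \<Rightarrow> (real \<Rightarrow> 'a) \<Rightarrow> real \<Rightarrow> real \<Rightarrow> bool" where
  "metric_piece J f u v \<longleftrightarrow> metric_on (f ` {u..v}) J \<and> lipschitz_path J u v f"

text \<open>Being a metric passes to the smaller image, and the Lipschitz constant is multiplied by
  \<open>\<bar>c\<bar>\<close>. It is applied with \<open>c = 1\<close> for subintervals,
  \<open>-1\<close> for reversal and 2 for joining.\<close>

lemma metric_piece_affine:
  assumes piece: "metric_piece J f u v"
    and h: "\<And>s. s \<in> {u'..v'} \<Longrightarrow> d + c * s \<in> {u..v} \<and> h s = f (d + c * s)"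
  shows "metric_piece J h u' v'"
proof -
  have "h ` {u'..v'} \<subseteq> f ` {u..v}"
    using h by auto
  then have "metric_on (h ` {u'..v'}) J"
    using piece unfolding metric_piece_def metric_on_def by (meson subsetD)
  moreover obtain C where C: "C \<ge> 0" "\<forall>s\<in>{u..v}. \<forall>t\<in>{u..v}. J (f s) (f t) \<le> C * \<bar>s - t\<bar>"
    using piece unfolding metric_piece_def lipschitz_path_def by blast
  have "J (h s) (h t) \<le> C * \<bar>c\<bar> * \<bar>s - t\<bar>" if "s \<in> {u'..v'}" "t \<in> {u'..v'}" for s t
  proof -
    have "J (h s) (h t) \<le> C * \<bar>(d + c * s) - (d + c * t)\<bar>"
      using h[OF that(1)] h[OF that(2)] C(2) by metis
    also have "\<bar>(d + c * s) - (d + c * t)\<bar> = \<bar>c\<bar> * \<bar>s - t\<bar>"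
      by (simp flip: right_diff_distrib abs_mult)
    finally show ?thesis by (simp add: mult.assoc)
  qed
  then have "lipschitz_path J u' v' h"
    using C(1) unfolding lipschitz_path_def by (intro exI[of _ "C * \<bar>c\<bar>"]) auto
  ultimately show ?thesis
    by (simp add: metric_piece_def)
qed

lemma metric_piece_subset:
  assumes "metric_piece J f u v" "u \<le> u'" "v' \<le> v"
  shows "metric_piece J f u' v'"
  by (rule metric_piece_affine[OF assms(1), where d = 0 and c = 1]) (use assms in auto)

lemma mem_Path_iff:
  "f \<in> Path N X J x y \<longleftrightarrow> f ` {0..1} \<subseteq> X \<and> continuous_path J 0 1 f \<and> f 0 = x \<and> f 1 = y \<and>
     (\<exists>p :: nat \<Rightarrow> real. p 0 = 0 \<and> p N = 1 \<and> (\<forall>i<N. p i < p (Suc i) \<and> metric_piece J f (p i) (p (Suc i))))"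
  by (auto simp: Path_def pw_paths_def metric_piece_def)

lemma partition_mono:
  fixes p :: "nat \<Rightarrow> real"
  assumes "\<And>i. i < N \<Longrightarrow> p i < p (Suc i)" "i \<le> j" "j \<le> N"
  shows "p i \<le> p j"
  using assms(2,3)
proof (induction j rule: dec_induct)
  case (step n)
  then show ?case using assms(1)[of n] by simp
qed simp

lemma partition_bounds:
  fixes p :: "nat \<Rightarrow> real"
  assumes "\<And>i. i < N \<Longrightarrow> p i < p (Suc i)" "p 0 = 0" "p N = 1" "i \<le> N"
  shows "0 \<le> p i" "p i \<le> 1"
  using partition_mono[of N p 0 i] partition_mono[of N p i N] assms by auto

text \<open>Partitions have exactly \<open>N\<close> intervals of positive length, so one more is
  obtained by halving the last. This makes \<open>D_N\<close> decreasing in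
  \<open>N\<close>.\<close>

lemma Path_Suc: "Path N X J x y \<subseteq> Path (Suc N) X J x y"
proof
  fix f assume f: "f \<in> Path N X J x y"
  then obtain p where p: "p 0 = 0" "p N = 1"
    and i: "\<And>i. i < N \<Longrightarrow> p i < p (Suc i)" "\<And>i. i < N \<Longrightarrow> metric_piece J f (p i) (p (Suc i))"
    by (auto simp: mem_Path_iff)
  \<comment> \<open>\<open>N = 0\<close> would give \<open>p 0\<close> the values 0 and 1 at
    once.\<close>
  then obtain M where M: "N = Suc M"
    by (metis not0_implies_Suc zero_neq_one)
  define q where "q k = (if k \<le> M then p k else if k = N then (p M + 1) / 2 else 1)" for k
  have "p M < 1"
    using i(1)[of M] p M by simp
  have "q k < q (Suc k) \<and> metric_piece J f (q k) (q (Suc k))" if "k < Suc N" for k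
  proof -
    have "k < M \<or> k = M \<or> k = N" using that M by linarith
    then consider "k < M" | "k = M" | "k = N" by blast
    then show ?thesis
    proof cases
      case 1
      then show ?thesis using i[of k] M by (simp add: q_def)
    next
      case 2
      then show ?thesis
        using metric_piece_subset[OF i(2)[of M], of "p M" "(p M + 1) / 2"] M p \<open>p M < 1\<close>
        by (simp add: q_def)
    next
      case 3
      then show ?thesis
        using metric_piece_subset[OF i(2)[of M], of "(p M + 1) / 2" 1] M p \<open>p M < 1\<close>
        by (simp add: q_def)
    qed
  qed
  moreover have "q 0 = 0" "q (Suc N) = 1"
    using p M by (auto simp: q_def)
  ultimately show "f \<in> Path (Suc N) X J x y"
    using f unfolding mem_Path_iff by blast
qed

lemma path_rev_Path:
  assumes "f \<in> Path N X J x y"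
  shows "path_rev f \<in> Path N X J y x"
proof -
  obtain p where p: "p 0 = 0" "p N = 1"
    and i: "\<And>i. i < N \<Longrightarrow> p i < p (Suc i)" "\<And>i. i < N \<Longrightarrow> metric_piece J f (p i) (p (Suc i))"
    using assms by (auto simp: mem_Path_iff)
  have cont: "continuous_path J 0 1 f"
    using assms by (simp add: mem_Path_iff)
  have "continuous_path J 0 1 (path_rev f)"
    unfolding continuous_path_def
  proof (intro allI impI, elim conjE)
    fix u :: "nat \<Rightarrow> real" and t :: real
    assume u: "\<forall>n. u n \<in> {0..1}" "t \<in> {0..1}" "u \<longlonglongrightarrow> t"
    have "(\<lambda>n. 1 - u n) \<longlonglongrightarrow> 1 - t"
      using u by (intro tendsto_intros)
    then show "(\<lambda>n. J (path_rev f (u n)) (path_rev f t)) \<longlonglongrightarrow> 0"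
      using cont[unfolded continuous_path_def, rule_format, of "\<lambda>n. 1 - u n" "1 - t"] u
      by (auto simp: path_rev_def)
  qed
  \<comment> \<open>Reflection reverses the order of the partition: piece \<open>k\<close> of the
    reversed path comes from piece \<open>N - Suc k\<close> of \<open>f\<close>.\<close>
  moreover have "1 - p (N - k) < 1 - p (N - Suc k) \<and>
      metric_piece J (path_rev f) (1 - p (N - k)) (1 - p (N - Suc k))" if "k < N" for k
  proof -
    have k: "N - k = Suc (N - Suc k)" "N - Suc k < N" using that by auto
    have "metric_piece J (path_rev f) (1 - p (N - k)) (1 - p (N - Suc k))"
      by (rule metric_piece_affine[OF i(2)[OF k(2)], where d = 1 and c = "-1"])
        (auto simp: path_rev_def k(1))
    then show ?thesis using i(1)[OF k(2)] k(1) by simp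
  qed
  ultimately show ?thesis
    using assms p unfolding mem_Path_iff
    by (auto simp: path_rev_def image_subset_iff intro!: exI[of _ "\<lambda>k. 1 - p (N - k)"])
qed

text \<open>A sequence tending to the junction may switch sides forever. Each path is therefore
  frozen outside its own half, and the sum of the two frozen distances, which tends to 0, dominates
  the distance along the joined path.\<close>

lemma continuous_path_join:
  assumes f: "continuous_path J 0 1 f" "f ` {0..1} \<subseteq> X"
    and g: "continuous_path J 0 1 g" "g ` {0..1} \<subseteq> X"
    and fg: "f 1 = g 0" and J: "\<forall>x\<in>X. \<forall>y\<in>X. 0 \<le> J x y"
  shows "continuous_path J 0 1 (path_join f g)"
  unfolding continuous_path_def
proof (intro allI impI, elim conjE)
  fix u :: "nat \<Rightarrow> real" and t :: real
  assume u: "\<forall>n. u n \<in> {0..1}" "t \<in> {0..1}" "u \<longlonglongrightarrow> t"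
  \<comment> \<open>\<open>v\<close> and \<open>w\<close> clamp \<open>s\<close> to the left and
    right half and rescale that half to \<open>{0..1}\<close>.\<close>
  define v where "v s = 2 * min s (1/2)" for s :: real
  define w where "w s = 2 * max s (1/2) - 1" for s :: real
  have vw: "v s \<in> {0..1}" "w s \<in> {0..1}" if "s \<in> {0..1}" for s
    using that by (auto simp: v_def w_def)
  have "(\<lambda>n. v (u n)) \<longlonglongrightarrow> v t" "(\<lambda>n. w (u n)) \<longlonglongrightarrow> w t"
    unfolding v_def w_def using u by (auto intro!: tendsto_intros)
  then have lim: "(\<lambda>n. J (f (v (u n))) (f (v t)) + J (g (w (u n))) (g (w t))) \<longlonglongrightarrow> 0"
    using f(1)[unfolded continuous_path_def, rule_format, of "\<lambda>n. v (u n)" "v t"]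
      g(1)[unfolded continuous_path_def, rule_format, of "\<lambda>n. w (u n)" "w t"] u vw
    by (intro tendsto_add_zero) auto
  have in_X: "f (v s) \<in> X" "g (w s) \<in> X" if "s \<in> {0..1}" for s
    using vw[OF that] f(2) g(2) by (auto simp: image_subset_iff)
  have left: "path_join f g s = f (v s)" if "s \<le> 1/2" for s
    using that by (simp add: path_join_def v_def min_def)
  have right: "path_join f g s = g (w s)" if "1/2 \<le> s" for s
    using path_join_right[of f g s] fg that by (simp add: w_def max.absorb1)
  have join_X: "path_join f g s \<in> X" if "s \<in> {0..1}" for s
    using left[of s] right[of s] in_X[OF that] by (cases "s \<le> 1/2") auto
  \<comment> \<open>Eventually \<open>u n\<close> and \<open>t\<close> share a closed half: by
    convergence if \<open>t\<close> is off the junction, and trivially at the junction, which lies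
    in both halves.\<close>
  have "\<forall>\<^sub>F n in sequentially. (u n \<le> 1/2 \<and> t \<le> 1/2) \<or> (1/2 \<le> u n \<and> 1/2 \<le> t)"
  proof (cases t "1/2 :: real" rule: linorder_cases)
    case less
    show ?thesis using order_tendstoD(2)[OF u(3) less] by eventually_elim (use less in auto)
  next
    case greater
    show ?thesis using order_tendstoD(1)[OF u(3) greater] by eventually_elim (use greater in auto)
  next
    case equal
    then have "u n \<le> 1/2 \<and> t \<le> 1/2 \<or> 1/2 \<le> u n \<and> 1/2 \<le> t" for n
      using linear[of "u n" "1/2"] by simp
    then show ?thesis by (intro always_eventually allI)
  qed
  then have "\<forall>\<^sub>F n in sequentially. J (path_join f g (u n)) (path_join f g t)
      \<le> J (f (v (u n))) (f (v t)) + J (g (w (u n))) (g (w t))"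
  proof eventually_elim
    case (elim n)
    have "0 \<le> J (f (v (u n))) (f (v t))" "0 \<le> J (g (w (u n))) (g (w t))"
      using u in_X J by auto
    then show ?case using elim left right by auto
  qed
  then show "(\<lambda>n. J (path_join f g (u n)) (path_join f g t)) \<longlonglongrightarrow> 0"
    by (intro tendsto_sandwich[OF _ _ tendsto_const lim]) (use u join_X J in auto)
qed

lemma path_join_Path:
  assumes f: "f \<in> Path N X J x z" and g: "g \<in> Path M X J z y"
    and J: "\<forall>x\<in>X. \<forall>y\<in>X. 0 \<le> J x y"
  shows "path_join f g \<in> Path (N + M) X J x y"
proof -
  obtain p where p: "p 0 = 0" "p N = 1"
    and pi: "\<And>i. i < N \<Longrightarrow> p i < p (Suc i)" "\<And>i. i < N \<Longrightarrow> metric_piece J f (p i) (p (Suc i))"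
    using f by (auto simp: mem_Path_iff)
  obtain q where q: "q 0 = 0" "q M = 1"
    and qi: "\<And>i. i < M \<Longrightarrow> q i < q (Suc i)" "\<And>i. i < M \<Longrightarrow> metric_piece J g (q i) (q (Suc i))"
    using g by (auto simp: mem_Path_iff)
  have fg: "f 1 = g 0" and fX: "f ` {0..1} \<subseteq> X" and gX: "g ` {0..1} \<subseteq> X"
    using f g by (auto simp: mem_Path_iff)
  \<comment> \<open>The two partitions are halved and placed end to end; at \<open>k = N\<close>
    both formulas give \<open>1/2\<close>, because \<open>p N = 1\<close> and
    \<open>q 0 = 0\<close>.\<close>
  define r where "r k = (if k \<le> N then p k / 2 else (1 + q (k - N)) / 2)" for k
  have r: "r k = (1 + q (k - N)) / 2" if "N \<le> k" for k
    using that p q by (cases "k = N") (auto simp: r_def)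
  have "r k < r (Suc k) \<and> metric_piece J (path_join f g) (r k) (r (Suc k))" if "k < N + M" for k
  proof (cases "k < N")
    case True
    have bd: "p (Suc k) \<le> 1"
      using partition_bounds[OF pi(1) p, of "Suc k"] True by simp
    have "metric_piece J (path_join f g) (p k / 2) (p (Suc k) / 2)"
      by (rule metric_piece_affine[OF pi(2)[OF True], where d = 0 and c = 2])
        (use bd in \<open>auto simp: path_join_def\<close>)
    then show ?thesis using True pi(1)[OF True] by (simp add: r_def)
  next
    case False
    define j where "j = k - N"
    have j: "j < M" "k = N + j" using False that by (auto simp: j_def)
    have bd: "0 \<le> q j"
      using partition_bounds[OF qi(1) q, of j] j by simp
    have "metric_piece J (path_join f g) ((1 + q j) / 2) ((1 + q (Suc j)) / 2)"
      by (rule metric_piece_affine[OF qi(2)[OF j(1)], where d = "-1" and c = 2])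
        (use bd path_join_right[of f g] fg in auto)
    moreover have "r k = (1 + q j) / 2" "r (Suc k) = (1 + q (Suc j)) / 2"
      using r[of k] r[of "Suc k"] j(2) by simp_all
    ultimately show ?thesis using qi(1)[OF j(1)] by (simp only:) simp
  qed
  moreover have "r 0 = 0" "r (N + M) = 1"
    using p q r[of "N + M"] by (auto simp: r_def)
  moreover have "path_join f g ` {0..1} \<subseteq> X"
    using fX gX by (auto simp: path_join_def image_subset_iff)
  moreover have "continuous_path J 0 1 (path_join f g)"
    using continuous_path_join[OF _ fX _ gX fg J] f g by (simp add: mem_Path_iff)
  moreover have "path_join f g 0 = x" "path_join f g 1 = y"
    using f g by (auto simp: path_join_def mem_Path_iff)
  ultimately show ?thesis
    unfolding mem_Path_iff by blast
qed

section \<open>The functions \<open>D_N\<close> and their limit \<open>D_J\<close>\<close>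

lemma D_N_eq_INF: "D_N N X J x y = (INF f\<in>Path N X J x y. ereal (path_len J 0 1 f))"
  \<comment> \<open>The infimum of the empty set is the top element, which is \<infinity> in
    \<open>ereal\<close>, so the case distinction collapses.\<close>
  by (simp add: D_N_def top_ereal_def)

lemma D_N_nonneg:
  assumes "\<forall>x\<in>X. \<forall>y\<in>X. 0 \<le> J x y"
  shows "0 \<le> D_N N X J x y"
  unfolding D_N_eq_INF using path_len_nonneg[OF _ assms]
  by (intro INF_greatest) (auto simp: mem_Path_iff)

lemma D_N_sym: "D_N N X J x y = D_N N X J y x"
proof -
  have le: "D_N N X J x y \<le> D_N N X J y x" for x y
    unfolding D_N_eq_INF
    by (rule INF_mono) (metis path_rev_Path path_len_rev order_refl)
  show ?thesis by (rule antisym[OF le le])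
qed

lemma D_N_triangle:
  assumes J: "\<forall>x\<in>X. \<forall>y\<in>X. 0 \<le> J x y"
  shows "D_N (N + M) X J x y \<le> D_N N X J x z + D_N M X J z y"
proof (cases "Path N X J x z = {} \<or> Path M X J z y = {}")
  case True
  then show ?thesis
    using D_N_nonneg[OF J] by (auto simp: D_N_def)
next
  case False
  let ?L = "\<lambda>f. ereal (path_len J 0 1 f)"
  have nonneg: "0 \<le> ?L f" if "f \<in> Path k X J u v" for f k u v
    using path_len_nonneg[OF _ J] that by (simp add: mem_Path_iff)
  have "D_N (N + M) X J x y \<le> ?L f + ?L g" if "f \<in> Path N X J x z" "g \<in> Path M X J z y" for f g
  proof -
    have "D_N (N + M) X J x y \<le> ?L (path_join f g)"
      unfolding D_N_eq_INF by (rule INF_lower[OF path_join_Path[OF that J]])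
    also have "\<dots> \<le> ?L f + ?L g"
      using path_len_join[OF _ _ _ J, of f g] that by (auto simp: mem_Path_iff)
    finally show ?thesis .
  qed
  then have "D_N (N + M) X J x y \<le> (INF f\<in>Path N X J x z. INF g\<in>Path M X J z y. ?L f + ?L g)"
    by (intro INF_greatest) auto
  \<comment> \<open>Constants are pulled out of the two infima in turn; nonempty path sets and
    nonnegative lengths justify this in \<open>ereal\<close>.\<close>
  also have "\<dots> = (INF f\<in>Path N X J x z. ?L f + D_N M X J z y)"
    unfolding D_N_eq_INF using False nonneg
    by (intro INF_cong refl INF_ereal_add_right) auto
  also have "\<dots> = D_N N X J x z + D_N M X J z y"
    unfolding D_N_eq_INF[of N] using False nonneg D_N_nonneg[OF J, of M z y]
    by (intro INF_ereal_add_left) auto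
  finally show ?thesis .
qed

text \<open>\<open>lim\<close> is informative only for a convergent sequence; a decreasing one in
  \<open>ereal\<close> converges to its infimum.\<close>

lemma D_N_tendsto_D_J: "(\<lambda>N. D_N N X J x y) \<longlonglongrightarrow> D_J X J x y"
proof -
  have "decseq (\<lambda>N. D_N N X J x y)"
    unfolding D_N_eq_INF by (intro decseq_SucI INF_superset_mono Path_Suc order_refl)
  from LIMSEQ_INF[OF this] show ?thesis
    unfolding D_J_def by (simp add: limI)
qed

theorem proposition3p8:
  fixes X :: "'a set" and J :: "'a \<Rightarrow> 'a \<Rightarrow> real"
  assumes "quasimetric_on X J"
  shows "pseudometric_on X (D_J X J) \<and>
    ((\<forall>x\<in>X. \<forall>y\<in>X. D_J X J x y \<noteq> \<infinity>) \<longrightarrow>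
       pseudometric_on X (\<lambda>x y. real_of_ereal (D_J X J x y)))"
proof -
  have J: "\<forall>x\<in>X. \<forall>y\<in>X. 0 \<le> J x y"
    using assms by (simp add: quasimetric_on_def)
  have nonneg: "0 \<le> D_J X J x y" for x y
    by (rule LIMSEQ_le_const[OF D_N_tendsto_D_J]) (use D_N_nonneg[OF J] in auto)
  have sym: "D_J X J x y = D_J X J y x" for x y
    unfolding D_J_def by (subst D_N_sym) (rule refl)
  have tri: "D_J X J x y \<le> D_J X J x z + D_J X J z y" for x y z
  proof (rule LIMSEQ_le)
    \<comment> \<open>Joining two \<open>N\<close>-piece paths doubles the number of pieces, but the
      even-indexed subsequence has the same limit.\<close>
    show "(\<lambda>N. D_N (N + N) X J x y) \<longlonglongrightarrow> D_J X J x y"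
      using LIMSEQ_subseq_LIMSEQ[OF D_N_tendsto_D_J, of "\<lambda>N. N + N"]
      by (simp add: strict_mono_def o_def)
    \<comment> \<open>Nonnegative limits keep away from \<infinity> + (-\<infinity>), where addition
      in \<open>ereal\<close> is not continuous.\<close>
    show "(\<lambda>N. D_N N X J x z + D_N N X J z y) \<longlonglongrightarrow> D_J X J x z + D_J X J z y"
      using nonneg[of x z] nonneg[of z y]
      by (intro tendsto_add_ereal_nonneg D_N_tendsto_D_J) auto
  qed (use D_N_triangle[OF J] in auto)
  \<comment> \<open>\<open>real_of_ereal\<close> sends \<infinity> to 0, which could break the
    triangle inequality; under \<open>fin\<close> it loses nothing.\<close>
  have "pseudometric_on X (\<lambda>x y. real_of_ereal (D_J X J x y))"
    if fin: "\<forall>x\<in>X. \<forall>y\<in>X. D_J X J x y \<noteq> \<infinity>"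
    unfolding pseudometric_on_def
  proof (intro conjI ballI)
    fix x y z assume "x \<in> X" "y \<in> X" "z \<in> X"
    then show "real_of_ereal (D_J X J x y)
        \<le> real_of_ereal (D_J X J x z) + real_of_ereal (D_J X J z y)"
      using tri[of x y z] fin nonneg[of x z] nonneg[of z y] nonneg[of x y]
      by (cases "D_J X J x y"; cases "D_J X J x z"; cases "D_J X J z y") auto
  qed (auto simp: nonneg real_of_ereal_pos intro: arg_cong[OF sym])
  moreover have "pseudometric_on X (D_J X J)"
    unfolding pseudometric_on_def by (intro conjI ballI nonneg sym tri)
  ultimately show ?thesis by blast
qed

end
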